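(* Let $\mathcal{M}\subset\mathbb{R}^N$ be a manifold equipped with a measure $\mu$, let $\Gamma$ be a group acting on $\mathcal{M}$, and let $x_{n+1}=F(x_n)$, $n\in\mathbb{N}$, with $F:\mathcal{M}\to\mathcal{M}$, be a $\Gamma$-equivariant discrete-time dynamical system on $\mathcal{M}$. Let $J\in\mathbb{N}$ and let $\mathcal{M}_1,\dots,\mathcal{M}_J\subset\mathcal{M}$ be pairwise disjoint invariant sets of the system whose union has full measure in $\mathcal{M}$. Suppose that for each $j\in\{1,\dots,J\}$ there exists some $\gamma_j\in\Gamma$ such that $\mathcal{M}_j=\gamma_j\mathcal{M}_1$, and fix such elements $\gamma_1,\dots,\gamma_J$. Suppose further that there exists a finite-dimensional Koopman invariant subspace of functions on $\mathcal{M}_1$, spanned by the components of an observation vector $\Phi$ restricted on $\mathcal{M}_1$, that linearly reconstructs the system state with measurement matrix $C$ (so $x=C\Phi(x)$ for all $x\in\mathcal{M}_1$), and let $K$ be the finite-dimensional representation of the Koopman operator in the basis $\Phi$ (so $\Phi(F(x))=K\Phi(x)$ for all $x\in\mathcal{M}_1$). Then for every $l\in\mathbb{N}$ and for almost every initial condition $x_n\in\mathcal{M}$, the $l$-step evolution $x_{n+l}=F^{(l)}(x_n)$ is given by $$x_{n+l}=\sum_{j=1}^{J}\chi_{\mathcal{M}_1}(\gamma_j^{-1}x_n)\,\gamma_j\, C K^l\,\Phi\left(\sum_{i=1}^{J}\chi_{\mathcal{M}_1}(\gamma_i^{-1}x_n)\,\gamma_i^{-1}x_n\right),$$ where $\chi_{\mathcal{M}_1}$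 is the indicator function of $\mathcal{M}_1$.
   Context: States are vectors in $\mathbb{R}^N$, and the sums and scalar multiples in the formula are taken in $\mathbb{R}^N$. The system $x_{n+1}=F(x_n)$ on $\mathcal{M}$ is $\Gamma$-equivariant with respect to the action of the group $\Gamma$ on $\mathcal{M}$ if $F(\gamma x)=\gamma F(x)$ for all $x\in\mathcal{M}$ and $\gamma\in\Gamma$. The set $\gamma_j\mathcal{M}_1$ is $\{\gamma_j x: x\in\mathcal{M}_1\}$. The map $F^{(l)}$ is the $l$-fold composition of $F$. A set $A\subset\mathcal{M}$ is invariant if $F(A)\subset A$. A set has full measure in $\mathcal{M}$ if its complement in $\mathcal{M}$ has $\mu$-measure zero; "almost every" is with respect to $\mu$. (In the underlying measure space, all subsets of $\mathcal{M}$ are taken to be measurable.) The Koopman operator acts on an observable $g$ by $\mathcal{K}g=g\circ F$. A finite-dimensional Koopman invariant subspace on $\mathcal{M}_1$ spanned by the observation vector $\Phi=(\phi_1,\dots,\phi_D)^\top:\mathcal{M}_1\to\mathbb{R}^D$ means: the real-valued functions $\phi_1,\dots,\phi_D$ on $\mathcal{M}_1$ are linearly independent and there is a matrix $K\in\mathbb{R}^{D\times D}$ (the finite-dimensional representation of the Koopman operator in the basis $\Phi$) with $\Phi(F(x))=K\Phi(x)$ for all $x\in\mathcal{M}_1$. It linearly reconstructs the state with measurement matrix $C\in\mathbb{R}^{N\times D}$ if $x=C\Phi(x)$ for all $x\in\mathcal{M}_1$. The indicator function is $\chi_{\mathcal{M}_1}(x)=1$ if $x\in\mathcal{M}_1$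 and $0$ otherwise. For $x_n\in\bigcup_{j}\mathcal{M}_j$, the argument of $\Phi$ in the formula lies in $\mathcal{M}_1$, so the formula is meaningful for almost every $x_n$; terms of the sums whose indicator coefficient is $0$ are read as the zero vector. *)

theory Defs
  imports "HOL-Analysis.Analysis" "HOL-Algebra.Group_Action"
begin

text \<open>A topological manifold of some fixed dimension \<open>d\<close>, as a subset of the ambient space. The
  Hausdorff property and second countability are inherited from the ambient space; no smoothness is
  required.\<close>

definition manifold :: "('a::euclidean_space) set \<Rightarrow> bool" where
  "manifold M \<longleftrightarrow>
    (\<exists>d. \<forall>x\<in>M. \<exists>U V. openin (top_of_set M) U \<and> x \<in> U \<and> openin (Euclidean_space d) V \<and>
      subtopology (top_of_set M) U homeomorphic_space subtopology (Euclidean_space d) V)"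

definition equivariant_on ::
    "('g, 'b) monoid_scheme \<Rightarrow> 'a set \<Rightarrow> ('g \<Rightarrow> 'a \<Rightarrow> 'a) \<Rightarrow> ('a \<Rightarrow> 'a) \<Rightarrow> bool" where
  "equivariant_on G M act F \<longleftrightarrow> (\<forall>x\<in>M. \<forall>g\<in>carrier G. F (act g x) = act g (F x))"

definition invariant_set :: "('a \<Rightarrow> 'a) \<Rightarrow> 'a set \<Rightarrow> bool" where
  "invariant_set F A \<longleftrightarrow> F ` A \<subseteq> A"

definition full_measure :: "'a measure \<Rightarrow> 'a set \<Rightarrow> bool" where
  "full_measure mu A \<longleftrightarrow> space mu - A \<in> null_sets mu"

definition koopman :: "('a \<Rightarrow> 'a) \<Rightarrow> ('a \<Rightarrow> 'b) \<Rightarrow> ('a \<Rightarrow> 'b)" where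
  "koopman F g = g \<circ> F"

text \<open>Functions on a set \<open>S\<close> are represented by total functions of which only the values on \<open>S\<close>
  are used; linear independence is that of the restrictions to \<open>S\<close> of the component functions.\<close>

definition lin_indep_components_on :: "'a set \<Rightarrow> ('a \<Rightarrow> real^'d) \<Rightarrow> bool" where
  "lin_indep_components_on S \<Phi> \<longleftrightarrow>
    (\<forall>c :: 'd \<Rightarrow> real. (\<forall>x\<in>S. (\<Sum>i\<in>UNIV. c i * \<Phi> x $ i) = 0) \<longrightarrow> (\<forall>i. c i = 0))"

definition koopman_matrix ::
    "('a \<Rightarrow> 'a) \<Rightarrow> 'a set \<Rightarrow> ('a \<Rightarrow> real^'d) \<Rightarrow> real^'d^'d \<Rightarrow> bool" where
  "koopman_matrix F S \<Phi> K \<longleftrightarrow> (\<forall>x\<in>S. koopman F \<Phi> x = K *v \<Phi> x)"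

definition spans_koopman_invariant_subspace ::
    "('a \<Rightarrow> 'a) \<Rightarrow> 'a set \<Rightarrow> ('a \<Rightarrow> real^'d) \<Rightarrow> bool" where
  "spans_koopman_invariant_subspace F S \<Phi> \<longleftrightarrow>
    lin_indep_components_on S \<Phi> \<and> (\<exists>K. koopman_matrix F S \<Phi> K)"

definition linearly_reconstructs ::
    "(real^'n) set \<Rightarrow> (real^'n \<Rightarrow> real^'d) \<Rightarrow> real^'d^'n \<Rightarrow> bool" where
  "linearly_reconstructs S \<Phi> C \<longleftrightarrow> (\<forall>x\<in>S. x = C *v \<Phi> x)"

text \<open>Power with respect to the matrix product; the operator \<open>^\<close> on \<open>real^'d^'d\<close> is the
  entrywise power.\<close>

definition matrix_power :: "real^'d^'d \<Rightarrow> nat \<Rightarrow> real^'d^'d" where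
  "matrix_power K l = (((**) K) ^^ l) (mat 1)"

end

theory Submission
  imports Defs
begin

text \<open>
  Almost every state \<open>x\<close> lies in exactly one copy \<open>A k = \<gamma>\<^sub>k A 1\<close> of the set \<open>A 1\<close>.  Since each \<open>\<gamma>\<^sub>j\<close>
  acts as a bijection, \<open>\<gamma>\<^sub>j\<inverse> x\<close> lies in \<open>A 1\<close> exactly when \<open>x\<close> lies in \<open>A j\<close>
  (\<open>inv_action_mem_iff\<close>), so the indicators select the index \<open>k\<close> and both sums collapse to
  their \<open>k\<close>-th term: the inner one to the representative \<open>y = \<gamma>\<^sub>k\<inverse> x\<close> in \<open>A 1\<close>, the outer one
  to \<open>\<gamma>\<^sub>k C K\<^sup>l \<Phi>(y)\<close>.

  On \<open>A 1\<close> the dynamics is linear in the coordinates \<open>\<Phi>\<close>: invariance keeps the orbit of \<open>y\<close>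
  inside \<open>A 1\<close>, hence \<open>\<Phi>(F\<^sup>l y) = K\<^sup>l \<Phi>(y)\<close> and \<open>F\<^sup>l y = C K\<^sup>l \<Phi>(y)\<close>
  (\<open>koopman_linear_evolution\<close>).  Equivariance of the iterates (\<open>equivariant_on_funpow\<close>) transports
  this back to \<open>x\<close>, because \<open>F\<^sup>l x = F\<^sup>l (\<gamma>\<^sub>k y) = \<gamma>\<^sub>k F\<^sup>l y\<close>.
\<close>

lemma invariant_set_funpow:
  assumes "invariant_set F S" "x \<in> S"
  shows "(F ^^ l) x \<in> S"
  using assms by (induction l) (auto simp: invariant_set_def)

lemma equivariant_on_funpow:
  assumes "equivariant_on G M act F" "invariant_set F M"
  shows "equivariant_on G M act (F ^^ l)"
  using assms invariant_set_funpow[OF assms(2)]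
  by (induction l) (auto simp: equivariant_on_def)

lemma matrix_power_Suc_mult_vec:
  "matrix_power K (Suc l) *v v = K *v (matrix_power K l *v v)"
  by (simp add: matrix_power_def matrix_vector_mul_assoc)

lemma koopman_matrix_funpow:
  assumes "koopman_matrix F S \<Phi> K" "invariant_set F S" "x \<in> S"
  shows "\<Phi> ((F ^^ l) x) = matrix_power K l *v \<Phi> x"
proof (induction l)
  case 0
  show ?case by (simp add: matrix_power_def)
next
  case (Suc l)
  have "\<Phi> ((F ^^ Suc l) x) = K *v \<Phi> ((F ^^ l) x)"
    using assms(1) invariant_set_funpow[OF assms(2,3)]
    by (simp add: koopman_matrix_def koopman_def)
  then show ?case by (simp add: Suc.IH matrix_power_Suc_mult_vec)
qed

lemma koopman_linear_evolution:
  assumes "koopman_matrix F S \<Phi> K" "linearly_reconstructs S \<Phi> C"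
    and "invariant_set F S" "x \<in> S"
  shows "(F ^^ l) x = (C ** matrix_power K l) *v \<Phi> x"
proof -
  have "(F ^^ l) x = C *v \<Phi> ((F ^^ l) x)"
    using assms(2) invariant_set_funpow[OF assms(3,4)]
    unfolding linearly_reconstructs_def by blast
  also have "\<dots> = (C ** matrix_power K l) *v \<Phi> x"
    unfolding koopman_matrix_funpow[OF assms(1,3,4)] by (rule matrix_vector_mul_assoc)
  finally show ?thesis .
qed

lemma inv_action_mem_iff:
  assumes "group_action G E act" "g \<in> carrier G" "S \<subseteq> E" "x \<in> E"
  shows "act (inv\<^bsub>G\<^esub> g) x \<in> S \<longleftrightarrow> x \<in> act g ` S"
proof -
  interpret group_action G E act by fact
  interpret group G by (rule group_hom.axioms(1)[OF group_hom])
  have "act g (act (inv\<^bsub>G\<^esub> g) x) = x"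
    using orbit_sym_aux[of "inv\<^bsub>G\<^esub> g" x] assms by simp
  moreover have "act (inv\<^bsub>G\<^esub> g) (act g y) = y" if "y \<in> S" for y
    using orbit_sym_aux[of g y] assms that by auto
  ultimately show ?thesis by (auto simp: image_iff intro!: bexI[of _ "act (inv\<^bsub>G\<^esub> g) x"])
qed

lemma sum_indicator_scaleR_select:
  fixes f :: "'i \<Rightarrow> 'v::real_vector"
  assumes "finite I" "k \<in> I" and "\<And>j. j \<in> I \<Longrightarrow> h j \<in> S \<longleftrightarrow> j = k"
  shows "(\<Sum>j\<in>I. indicator S (h j) *\<^sub>R f j) = f k"
proof -
  have "(\<Sum>j\<in>I. indicator S (h j) *\<^sub>R f j) = (\<Sum>j\<in>I. if j = k then f j else 0)"
    using assms(3) by (intro sum.cong) (auto simp: indicator_def)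
  then show ?thesis using assms(1,2) by simp
qed

theorem theorem4p5:
  fixes M :: "(real^'n) set"
    and mu :: "(real^'n) measure"
    and G :: "('g, 'b) monoid_scheme"
    and act :: "'g \<Rightarrow> real^'n \<Rightarrow> real^'n"
    and F :: "real^'n \<Rightarrow> real^'n"
    and J :: nat
    and A :: "nat \<Rightarrow> (real^'n) set"
    and \<gamma> :: "nat \<Rightarrow> 'g"
    and \<Phi> :: "real^'n \<Rightarrow> real^'d"
    and K :: "real^'d^'d"
    and C :: "real^'d^'n"
  assumes "manifold M"
    and "space mu = M" and "sets mu = Pow M"
    and "group_action G M act"
    and "F \<in> M \<rightarrow> M"
    and "equivariant_on G M act F"
    and "1 \<le> J"
    and "\<And>j. j \<in> {1..J} \<Longrightarrow> A j \<subseteq> M"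
    and "\<And>j. j \<in> {1..J} \<Longrightarrow> invariant_set F (A j)"
    and "disjoint_family_on A {1..J}"
    and "full_measure mu (\<Union>j\<in>{1..J}. A j)"
    and "\<And>j. j \<in> {1..J} \<Longrightarrow> \<gamma> j \<in> carrier G"
    and "\<And>j. j \<in> {1..J} \<Longrightarrow> A j = act (\<gamma> j) ` A 1"
    and "spans_koopman_invariant_subspace F (A 1) \<Phi>"
    and "koopman_matrix F (A 1) \<Phi> K"
    and "linearly_reconstructs (A 1) \<Phi> C"
  shows "\<forall>l. AE x in mu. (F ^^ l) x =
    (\<Sum>j = 1..J. indicator (A 1) (act (inv\<^bsub>G\<^esub> (\<gamma> j)) x) *\<^sub>R
      act (\<gamma> j) ((C ** matrix_power K l) *v
        \<Phi> (\<Sum>i = 1..J. indicator (A 1) (act (inv\<^bsub>G\<^esub> (\<gamma> i)) x) *\<^sub>R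
          act (inv\<^bsub>G\<^esub> (\<gamma> i)) x)))"
proof -
  note acts = \<open>group_action G M act\<close>
  have sub: "A 1 \<subseteq> M" and inv1: "invariant_set F (A 1)"
    using assms(7-9) by auto
  have formula: "(F ^^ l) x =
    (\<Sum>j = 1..J. indicator (A 1) (act (inv\<^bsub>G\<^esub> (\<gamma> j)) x) *\<^sub>R
      act (\<gamma> j) ((C ** matrix_power K l) *v
        \<Phi> (\<Sum>i = 1..J. indicator (A 1) (act (inv\<^bsub>G\<^esub> (\<gamma> i)) x) *\<^sub>R
          act (inv\<^bsub>G\<^esub> (\<gamma> i)) x)))" (is "_ = ?rhs x")
    if k: "k \<in> {1..J}" and x: "x \<in> A k" for x k l
  proof -
    let ?y = "act (inv\<^bsub>G\<^esub> (\<gamma> k)) x"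
    have select: "act (inv\<^bsub>G\<^esub> (\<gamma> j)) x \<in> A 1 \<longleftrightarrow> j = k" if j: "j \<in> {1..J}" for j
    proof -
      have "act (inv\<^bsub>G\<^esub> (\<gamma> j)) x \<in> A 1 \<longleftrightarrow> x \<in> A j"
        using inv_action_mem_iff[OF acts assms(12)[OF j] sub] assms(8)[OF k] x
        unfolding assms(13)[OF j] by blast
      also have "\<dots> \<longleftrightarrow> j = k"
        using disjoint_family_onD[OF assms(10) j k] x by auto
      finally show ?thesis .
    qed
    have y: "?y \<in> A 1" using select[OF k] by simp
    obtain z where z: "z \<in> A 1" "x = act (\<gamma> k) z"
      using x assms(13)[OF k] by blast
    have x_eq: "x = act (\<gamma> k) ?y"
      using z sub group_action.orbit_sym_aux[OF acts assms(12)[OF k], of z x] by auto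
    have "?rhs x = act (\<gamma> k) ((C ** matrix_power K l) *v \<Phi> ?y)"
      by (simp only: sum_indicator_scaleR_select[OF finite_atLeastAtMost k select])
    also have "\<dots> = act (\<gamma> k) ((F ^^ l) ?y)"
      by (simp add: koopman_linear_evolution[OF assms(15,16) inv1 y])
    also have "\<dots> = (F ^^ l) (act (\<gamma> k) ?y)"
    proof -
      have "invariant_set F M" using assms(5) by (auto simp: invariant_set_def)
      then have "equivariant_on G M act (F ^^ l)"
        by (rule equivariant_on_funpow[OF assms(6)])
      then show ?thesis using y sub assms(12)[OF k] by (auto simp: equivariant_on_def)
    qed
    also have "\<dots> = (F ^^ l) x" by (simp flip: x_eq)
    finally show ?thesis by simp
  qed
  show ?thesis
  proof (intro allI AE_I')
    show "space mu - (\<Union>j\<in>{1..J}. A j) \<in> null_sets mu"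
      using assms(11) by (simp add: full_measure_def)
  qed (use formula in blast)
qed

end
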